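(* Let $G$ be a group of (finite) order $n$ with $Z(G)=1$. If $G$ is integrable, then it has an integral of order at most $n^{\log_2 n}$.
   Context: $Z(G)$ denotes the centre of $G$. For a group $H$, $H'$ denotes its derived group (commutator subgroup). An integral of a group $G$ is a group $H$ such that $H'$ is isomorphic to $G$; $G$ is integrable if it has an integral. *)

theory Defs
  imports Complex_Main "HOL-Algebra.Algebra"
begin

definition centre :: "('a, 'm) monoid_scheme \<Rightarrow> 'a set" where
  "centre G = {z \<in> carrier G. \<forall>g \<in> carrier G. z \<otimes>\<^bsub>G\<^esub> g = g \<otimes>\<^bsub>G\<^esub> z}"

text \<open>The element types of \<open>H\<close> and \<open>G\<close> are independent, and \<open>H\<close> may be infinite.\<close>

definition is_integral :: "('b, 'k) monoid_scheme \<Rightarrow> ('a, 'm) monoid_scheme \<Rightarrow> bool" where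
  "is_integral H G \<longleftrightarrow> group H \<and> H\<lparr>carrier := derived H (carrier H)\<rparr> \<cong> G"

end

(* Let H be an integral of G. The conjugation action of H on H' has as kernel the centralizer of H',
   which meets H' in Z(H') = 1. So H' embeds in the image K of the action, and K' is the image of H'.
   An element of K is determined by its values on a generating set of H'. By Lagrange such a set can be
   chosen with at most log_2 n elements, each of which has at most n possible images. *)

theory Submission
  imports Defs
begin

definition centralizer :: "('a, 'm) monoid_scheme \<Rightarrow> 'a set \<Rightarrow> 'a set" where
  "centralizer G A = {g \<in> carrier G. \<forall>x \<in> A. g \<otimes>\<^bsub>G\<^esub> x = x \<otimes>\<^bsub>G\<^esub> g}"

lemma (in group) subgroup_centralizer:
  assumes "A \<subseteq> carrier G"
  shows "subgroup (centralizer G A) G"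
proof (rule subgroupI)
  show "centralizer G A \<subseteq> carrier G"
    by (auto simp: centralizer_def)
  have "\<one> \<in> centralizer G A"
    using assms by (auto simp: centralizer_def)
  then show "centralizer G A \<noteq> {}" by blast
next
  fix a assume a: "a \<in> centralizer G A"
  have "inv a \<otimes> x = x \<otimes> inv a" if "x \<in> A" for x
  proof -
    have "x \<in> carrier G" "a \<in> carrier G" "a \<otimes> x = x \<otimes> a"
      using a that assms by (auto simp: centralizer_def)
    then have "inv a \<otimes> (x \<otimes> a) = x"
      using inv_solve_left' by simp
    then show ?thesis
      using \<open>x \<in> carrier G\<close> \<open>a \<in> carrier G\<close> by (simp add: inv_solve_right m_assoc)
  qed
  then show "inv a \<in> centralizer G A"
    using a by (auto simp: centralizer_def)
next
  fix a b assume "a \<in> centralizer G A" "b \<in> centralizer G A"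
  moreover have "a \<otimes> b \<otimes> x = x \<otimes> (a \<otimes> b)"
    if "a \<in> carrier G" "b \<in> carrier G" "x \<in> carrier G" "a \<otimes> x = x \<otimes> a" "b \<otimes> x = x \<otimes> b" for x
    using that by (metis m_assoc)
  ultimately show "a \<otimes> b \<in> centralizer G A"
    using assms by (auto simp: centralizer_def)
qed

text \<open>Commuting is symmetric: if \<open>g\<close> commutes with \<open>A\<close>, then
  \<open>A\<close> lies in the subgroup \<open>centralizer G {g}\<close>, which then contains
  everything \<open>A\<close> generates.\<close>

lemma (in group) centralizer_generate:
  assumes "A \<subseteq> carrier G"
  shows "centralizer G (generate G A) = centralizer G A"
proof
  show "centralizer G (generate G A) \<subseteq> centralizer G A"
    using generate.incl[of _ A G] by (auto simp: centralizer_def)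
next
  show "centralizer G A \<subseteq> centralizer G (generate G A)"
  proof
    fix g assume g: "g \<in> centralizer G A"
    then have "g \<in> carrier G" "A \<subseteq> centralizer G {g}"
      using assms by (auto simp: centralizer_def)
    then have "generate G A \<subseteq> centralizer G {g}"
      using generate_subgroup_incl subgroup_centralizer by simp
    then show "g \<in> centralizer G (generate G A)"
      using \<open>g \<in> carrier G\<close> by (auto simp: centralizer_def)
  qed
qed

text \<open>This describes the fibres of the conjugation action as cosets of its kernel. Conjugating
  as \<open>inv a \<otimes> x \<otimes> a\<close> gives the quotient
  \<open>a \<otimes> inv b\<close>, the form in which \<open>weak_group_morphismsI\<close> takes the
  fibre condition.\<close>

lemma (in group) mem_centralizer_iff_conj:
  assumes "A \<subseteq> carrier G" and "a \<in> carrier G" and "b \<in> carrier G"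
  shows "a \<otimes> inv b \<in> centralizer G A \<longleftrightarrow> (\<forall>x \<in> A. inv a \<otimes> x \<otimes> a = inv b \<otimes> x \<otimes> b)"
proof -
  have "a \<otimes> inv b \<otimes> x = x \<otimes> (a \<otimes> inv b) \<longleftrightarrow> inv a \<otimes> x \<otimes> a = inv b \<otimes> x \<otimes> b"
    if x: "x \<in> carrier G" for x
  proof -
    have "inv a \<otimes> x \<otimes> a = inv b \<otimes> x \<otimes> b \<longleftrightarrow> inv a \<otimes> (x \<otimes> a) = inv b \<otimes> x \<otimes> b"
      using assms x by (simp add: m_assoc)
    also have "\<dots> \<longleftrightarrow> x \<otimes> a = a \<otimes> (inv b \<otimes> x \<otimes> b)"
      using assms x by (intro inv_solve_left') auto
    also have "\<dots> \<longleftrightarrow> x \<otimes> a = (a \<otimes> inv b \<otimes> x) \<otimes> b"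
      using assms x by (simp add: m_assoc)
    also have "\<dots> \<longleftrightarrow> a \<otimes> inv b \<otimes> x = x \<otimes> a \<otimes> inv b"
      using assms x by (intro inv_solve_right[symmetric]) auto
    finally show ?thesis
      using assms x by (simp add: m_assoc)
  qed
  then show ?thesis
    using assms by (auto simp: centralizer_def subset_iff)
qed

lemma (in group) centralizer_normal:
  assumes "N \<lhd> G"
  shows "centralizer G N \<lhd> G"
  unfolding normal_inv_iff
proof (intro conjI ballI)
  interpret N: normal N G by fact
  show "subgroup (centralizer G N) G"
    using subgroup_centralizer N.subset by blast
  fix g h assume g: "g \<in> carrier G" and h: "h \<in> centralizer G N"
  have hc: "h \<in> carrier G" using h by (simp add: centralizer_def)
  \<comment> \<open>Normality puts the conjugate of \<open>x\<close> by \<open>g\<close> back into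
    \<open>N\<close>, where \<open>h\<close> commutes with it. Conjugating this equation by
    \<open>inv g\<close> turns it into the one required.\<close>
  have "(inv g \<otimes> x \<otimes> g) \<otimes> h = h \<otimes> (inv g \<otimes> x \<otimes> g)" if "x \<in> N" for x
    using h N.inv_op_closed1[OF g that] by (simp add: centralizer_def)
  moreover have "g \<otimes> h \<otimes> inv g \<otimes> x = g \<otimes> (h \<otimes> (inv g \<otimes> x \<otimes> g)) \<otimes> inv g" if "x \<in> N" for x
    using g hc N.subset that by (auto simp: m_assoc subset_iff)
  moreover have "x \<otimes> (g \<otimes> h \<otimes> inv g) = g \<otimes> ((inv g \<otimes> x \<otimes> g) \<otimes> h) \<otimes> inv g" if "x \<in> N" for x
    using g hc N.subset that by (auto simp: m_assoc[symmetric] subset_iff)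
  ultimately show "g \<otimes> h \<otimes> inv g \<in> centralizer G N"
    using g hc by (auto simp: centralizer_def)
qed

text \<open>Among the sets \<open>S\<close> that generate at least \<open>2 ^ card S\<close>
  elements, take one whose generated subgroup is largest. If it missed some \<open>x\<close>,
  adjoining \<open>x\<close> would at least double the subgroup by Lagrange while adding one
  generator, against maximality.\<close>

lemma (in group) exists_small_generating_set:
  assumes fin: "finite (carrier G)"
  shows "\<exists>S. S \<subseteq> carrier G \<and> generate G S = carrier G \<and> 2 ^ card S \<le> order G"
proof -
  let ?P = "\<lambda>S. S \<subseteq> carrier G \<and> 2 ^ card S \<le> card (generate G S)"
  have "?P {}"
    by (simp add: generate_empty)
  moreover have "card (generate G S) \<le> order G" if "?P S" for S
    using that card_mono[OF fin] generate_incl by (simp add: order_def)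
  ultimately obtain S where S: "?P S"
    and max: "\<And>T. ?P T \<Longrightarrow> card (generate G T) \<le> card (generate G S)"
    using ex_has_greatest_nat[of ?P "{}" "\<lambda>S. card (generate G S)" "Suc (order G)"] less_Suc_eq_le by blast
  have "generate G S = carrier G"
  proof (rule ccontr)
    assume "generate G S \<noteq> carrier G"
    then obtain x where x: "x \<in> carrier G" "x \<notin> generate G S"
      using S generate_incl by blast
    let ?T = "generate G (insert x S)"
    have sub: "generate G S \<subseteq> ?T" by (rule mono_generate) auto
    have sT: "subgroup ?T G" using S x by (simp add: generate_is_subgroup)
    have sS: "subgroup (generate G S) G" using S by (simp add: generate_is_subgroup)
    interpret T: group "G\<lparr>carrier := ?T\<rparr>" using sT by (rule subgroup_imp_group)
    have "subgroup (generate G S) (G\<lparr>carrier := ?T\<rparr>)"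
      using subgroup_incl sS sT sub by blast
    then have "card (generate G S) dvd card ?T"
      using T.lagrange[of "generate G S"]
        by (simp add: order_def) (metis dvd_triv_right)
    then obtain k where k: "card ?T = card (generate G S) * k" by (auto elim: dvdE)
    have "finite ?T" using sT fin finite_subset subgroup.subset by blast
    moreover have "x \<in> ?T" by (simp add: generate.incl)
    ultimately have less: "card (generate G S) < card ?T"
      using sub x by (intro psubset_card_mono) auto
    \<comment> \<open>\<open>k\<close> is the index of the old subgroup in the new one; a strict
      inclusion forces it to be at least 2.\<close>
    then have "k \<noteq> 0" "k \<noteq> 1" using k by auto
    then have "2 * card (generate G S) \<le> card ?T" using k by simp
    moreover have "finite S" "x \<notin> S"
      using S fin finite_subset x generate.incl[of x S G] by auto
    ultimately have "?P (insert x S)" using S x by auto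
    then have "card ?T \<le> card (generate G S)" by (rule max)
    then show False using less by simp
  qed
  then show ?thesis using S by (auto simp: order_def)
qed

text \<open>This carries the triviality of the centre from \<open>G\<close> over to the derived
  group of an integral.\<close>

lemma iso_centre:
  assumes f: "f \<in> iso G H" and "z \<in> centre G"
  shows "f z \<in> centre H"
proof -
  have "f z \<otimes>\<^bsub>H\<^esub> h = h \<otimes>\<^bsub>H\<^esub> f z" if "h \<in> carrier H" for h
  proof -
    have hom: "f \<in> hom G H" and "h \<in> f ` carrier G"
      using f that by (auto simp: iso_def bij_betw_def)
    then obtain g where g: "g \<in> carrier G" "h = f g" by blast
    have z: "z \<in> carrier G" "z \<otimes>\<^bsub>G\<^esub> g = g \<otimes>\<^bsub>G\<^esub> z"
      using \<open>z \<in> centre G\<close> g by (auto simp: centre_def)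
    then show ?thesis
      using g by (simp flip: hom_mult[OF hom])
  qed
  moreover have "f z \<in> carrier H"
    using f \<open>z \<in> centre G\<close> by (auto simp: iso_def hom_def centre_def)
  ultimately show ?thesis by (simp add: centre_def)
qed

theorem corollary5p4:
  fixes G :: "('a, 'm) monoid_scheme"
    and H :: "('b, 'k) monoid_scheme"
    and n :: nat
  assumes "group G"
    and "finite (carrier G)"
    and "order G = n"
    and "centre G = {\<one>\<^bsub>G\<^esub>}"
    and "is_integral H G"
  shows "\<exists>K :: nat monoid. is_integral K G \<and> finite (carrier K) \<and>
           real (order K) \<le> real n powr log 2 (real n)"
proof -
  interpret H: group H using assms(5) by (simp add: is_integral_def)
  define D where "D = derived H (carrier H)"
  let ?D = "H\<lparr>carrier := D\<rparr>"
  have normD: "D \<lhd> H" unfolding D_def by (rule H.derived_self_is_normal)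
  interpret D: normal D H by fact
  have groupD: "group ?D" by (rule H.subgroup_imp_group[OF D.is_subgroup])
  have "?D \<cong> G" using assms(5) by (simp add: is_integral_def D_def)
  then obtain \<phi> where \<phi>: "\<phi> \<in> iso ?D G" by (auto simp: is_iso_def)
  have bij: "bij_betw \<phi> D (carrier G)" using \<phi> by (simp add: iso_def)
  have finD: "finite D" using bij assms(2) bij_betw_finite by blast
  have cardD: "card D = n" using bij bij_betw_same_card assms(3) by (fastforce simp: order_def)
  have trivial: "x = \<one>\<^bsub>H\<^esub>" if "x \<in> D" "x \<in> centralizer H D" for x
  proof -
    have "x \<in> centre ?D" using that by (auto simp: centre_def centralizer_def)
    then have "\<phi> x = \<one>\<^bsub>G\<^esub>"
      using iso_centre[OF \<phi>] assms(4) by blast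
    moreover have "\<phi> \<one>\<^bsub>H\<^esub> = \<one>\<^bsub>G\<^esub>"
      using hom_one[of \<phi> ?D G] \<phi> groupD assms(1) by (simp add: iso_def)
    ultimately show ?thesis
      using bij that(1) D.one_closed by (auto simp: bij_betw_def inj_on_def)
  qed
  obtain S where "S \<subseteq> D" "generate ?D S = D" and cardS: "2 ^ card S \<le> n"
    using group.exists_small_generating_set[OF groupD] finD cardD by (auto simp: order_def)
  \<comment> \<open>Generation inside the subgroup \<open>D\<close> agrees with generation in
    \<open>H\<close>, where the centralizers are taken.\<close>
  then have S: "S \<subseteq> D" "generate H S = D"
    using H.generate_consistent[OF _ D.is_subgroup] by auto
  have SH: "S \<subseteq> carrier H" using S(1) D.subset by blast
  have finS: "finite S" using S(1) finD finite_subset by blast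
  let ?X = "S \<rightarrow>\<^sub>E D"
  have finX: "finite ?X" using finS finD by (simp add: finite_PiE)
  \<comment> \<open>Numbering the finitely many functions from \<open>S\<close> to \<open>D\<close>
    lets the new integral live on \<open>nat\<close>, even when \<open>H\<close> is
    infinite.\<close>
  then obtain e :: "('b \<Rightarrow> 'b) \<Rightarrow> nat" where e: "inj_on e ?X"
    using finite_imp_inj_to_nat_seg by blast
  \<comment> \<open>\<open>c h\<close> records conjugation by \<open>h\<close> on the generators
    only. The restriction to \<open>S\<close> makes two such functions equal exactly when they agree
    on \<open>S\<close>.\<close>
  define c where "c h = (\<lambda>x\<in>S. inv\<^bsub>H\<^esub> h \<otimes>\<^bsub>H\<^esub> x \<otimes>\<^bsub>H\<^esub> h)" for h
  have cX: "c h \<in> ?X" if "h \<in> carrier H" for h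
    using that S(1) D.inv_op_closed1 by (auto simp: c_def)
  let ?f = "e \<circ> c"
  have f_eq: "?f a = ?f b \<longleftrightarrow> a \<otimes>\<^bsub>H\<^esub> inv\<^bsub>H\<^esub> b \<in> centralizer H D"
    if "a \<in> carrier H" "b \<in> carrier H" for a b
  proof -
    have "?f a = ?f b \<longleftrightarrow> c a = c b" using e cX that by (auto simp: inj_on_def)
    also have "\<dots> \<longleftrightarrow> (\<forall>x\<in>S. inv\<^bsub>H\<^esub> a \<otimes>\<^bsub>H\<^esub> x \<otimes>\<^bsub>H\<^esub> a = inv\<^bsub>H\<^esub> b \<otimes>\<^bsub>H\<^esub> x \<otimes>\<^bsub>H\<^esub> b)"
      unfolding c_def by (metis (no_types, lifting) restrict_apply' restrict_ext)
    finally show ?thesis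
      using H.mem_centralizer_iff_conj[OF SH that] H.centralizer_generate[OF SH] S(2) by simp
  qed
  \<comment> \<open>\<open>?K\<close> is a copy of \<open>H\<close> modulo
    \<open>centralizer H D\<close>: its elements are the codes of the restricted conjugations,
    multiplied through preimages under \<open>?f\<close>.\<close>
  let ?K = "image_group ?f H"
  have "weak_group_morphism ?f (centralizer H D) H"
    using f_eq H.centralizer_normal[OF normD] by (intro weak_group_morphismsI)
  then interpret f: group_hom H ?K ?f
    by (rule H.weak_group_morphism_group_hom)
  have "inj_on ?f D"
  proof (rule inj_onI)
    fix a b assume ab: "a \<in> D" "b \<in> D" "?f a = ?f b"
    then have "a \<otimes>\<^bsub>H\<^esub> inv\<^bsub>H\<^esub> b \<in> centralizer H D"
      using f_eq D.subset by blast
    then have "a \<otimes>\<^bsub>H\<^esub> inv\<^bsub>H\<^esub> b = \<one>\<^bsub>H\<^esub>" using trivial ab by simp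
    then show "a = b" using ab D.subset by (metis H.inv_equality H.inv_inv H.inv_closed subsetD)
  qed
  then have "?f \<in> iso ?D (?K\<lparr>carrier := ?f ` D\<rparr>)"
    using f.hom_mult D.subset by (auto simp: iso_def bij_betw_def hom_def)
  \<comment> \<open>A homomorphism maps the derived group onto that of its image, and
    \<open>?f\<close> is onto \<open>?K\<close>.\<close>
  moreover have "derived ?K (carrier ?K) = ?f ` D"
    using f.derived_img[of "carrier H"] by (simp add: D_def image_group_carrier)
  ultimately have "?K\<lparr>carrier := derived ?K (carrier ?K)\<rparr> \<cong> G"
    using \<phi> groupD group.iso_sym iso_trans is_isoI by metis
  then have "is_integral ?K G"
    by (simp add: is_integral_def f.is_group)
  moreover have sub: "carrier ?K \<subseteq> e ` ?X"
    using cX by (auto simp: image_group_carrier)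
  then have "finite (carrier ?K)" using finX finite_subset by blast
  moreover have "real (order ?K) \<le> real n powr log 2 (real n)"
  proof -
    \<comment> \<open>A base of at least 1 makes \<open>powr\<close> agree with the natural power
      and be monotone in the exponent.\<close>
    have n: "n \<ge> 1" using cardS by (metis less_one not_le le_trans one_le_power one_le_numeral)
    have "order ?K \<le> card ?X"
      unfolding order_def using sub finX by (meson card_image_le card_mono finite_imageI le_trans)
    also have "\<dots> = n ^ card S" using finS cardD by (simp add: card_PiE)
    finally have "real (order ?K) \<le> real n ^ card S" by (metis of_nat_le_iff of_nat_power)
    also have "\<dots> = real n powr real (card S)" using n by (simp add: powr_realpow)
    \<comment> \<open>Taking logarithms in \<open>2 ^ card S \<le> n\<close> bounds the
      exponent.\<close>
    also have "\<dots> \<le> real n powr log 2 (real n)"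
      using n cardS le_log2_of_power by (intro powr_mono) auto
    finally show ?thesis .
  qed
  ultimately show ?thesis by blast
qed

end
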